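(* Let $n \geq 1$ and let $\Delta$ be a color-shifted, $n$-colored simplicial complex (with colors $[n]=\{1,\dots,n\}$). Then there exist an integer $m$ and an $m$-colored simplicial complex $\Gamma$ (with colors $[m]=\{1,\dots,m\}$) such that (1) the color-selected subcomplex of $\Gamma$ for the color set $[n]$ is $\Delta$, and (2) $\Gamma$ is color-shifted, and every color-shifted $m$-colored simplicial complex $\Sigma$ with $f_S(\Sigma)=f_S(\Gamma)$ for all $S\subset[m]$ satisfies $\Sigma=\Gamma$.
   Context: A simplicial complex $\Delta$ on a vertex set $W$ is a collection of subsets of $W$ (faces) such that $\{v\}\in\Delta$ for every $v\in W$ and $\Delta$ is closed under taking subsets. An $n$-coloring assigns to each vertex a color in $[n]$ so that no two vertices of a face share a color; an $n$-colored complex is a complex with such a coloring. The color set of a face is the set of colors of its vertices. For $S\subset[n]$, the flag f-number $f_S(\Delta)$ is the number of faces of $\Delta$ with color set $S$; the flag f-vector $f(\Delta)$ is the collection of all $f_S(\Delta)$. For each color $i$, the vertices of color $i$ are given a fixed order and labeled $v^i_1, v^i_2,\dots,v^i_{f_{\{i\}}(\Delta)}$. The complex is color-shifted if whenever $\{v^{i_1}_{a_1},\dots,v^{i_j}_{a_j}\}\in\Delta$ (distinct colors $i_1,\dots,i_j$) and $b_1\le a_1,\dots,b_j\le a_j$ (positive integers), also $\{v^{i_1}_{b_1},\dots,v^{i_j}_{b_j}\}\in\Delta$. For $S\subset[n]$, the color-selected subcomplex of $\Delta$ for $S$ is the subcomplex consisting of all faces of $\Delta$ whose color set is a subset of $S$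 (with the same coloring and vertex labeling). *)

theory Defs
  imports Main
begin

definition simplicial_complex :: "'v set \<Rightarrow> 'v set set \<Rightarrow> bool" where
  "simplicial_complex W \<Delta> \<longleftrightarrow>
     finite W \<and>
     (\<forall>F\<in>\<Delta>. F \<subseteq> W) \<and>
     (\<forall>v\<in>W. {v} \<in> \<Delta>) \<and>
     (\<forall>F\<in>\<Delta>. \<forall>G. G \<subseteq> F \<longrightarrow> G \<in> \<Delta>)"

definition coloring :: "nat \<Rightarrow> ('v \<Rightarrow> nat) \<Rightarrow> 'v set \<Rightarrow> 'v set set \<Rightarrow> bool" where
  "coloring n c W \<Delta> \<longleftrightarrow>
     (\<forall>v\<in>W. c v \<in> {1..n}) \<and>
     (\<forall>F\<in>\<Delta>. \<forall>v\<in>F. \<forall>w\<in>F. v \<noteq> w \<longrightarrow> c v \<noteq> c w)"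

text \<open>The vertex \<open>v\<^sup>i\<^sub>a\<close>, i.e. the \<open>a\<close>-th vertex of color \<open>i\<close>, is the pair \<open>(i, a)\<close>, with
  \<open>a\<close> counted from 1. A colored complex with labeled vertices is thus a set of faces over such
  pairs, and equality of these sets is equality of complexes including coloring and labeling.\<close>

type_synonym vertex = "nat \<times> nat"

abbreviation color :: "vertex \<Rightarrow> nat" where
  "color \<equiv> fst"

definition color_set :: "vertex set \<Rightarrow> nat set" where
  "color_set F = color ` F"

definition flag_f :: "vertex set set \<Rightarrow> nat set \<Rightarrow> nat" where
  "flag_f \<Delta> S = card {F \<in> \<Delta>. color_set F = S}"

text \<open>The vertex set of a complex is necessarily the union of its faces. The last conjunct
  says that the vertices of color \<open>i\<close> are labeled \<open>v\<^sup>i\<^sub>1, \<dots>, v\<^sup>i\<^sub>k\<close>, where \<open>k\<close> is the flag f-number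
  of \<open>{i}\<close>.\<close>

definition colored_complex :: "nat \<Rightarrow> vertex set set \<Rightarrow> bool" where
  "colored_complex n \<Delta> \<longleftrightarrow>
     simplicial_complex (\<Union>\<Delta>) \<Delta> \<and>
     coloring n color (\<Union>\<Delta>) \<Delta> \<and>
     (\<forall>i\<in>{1..n}. {v \<in> \<Union>\<Delta>. color v = i} = {(i, a) | a. 1 \<le> a \<and> a \<le> flag_f \<Delta> {i}})"

text \<open>A face with color set \<open>I\<close> is given by the function \<open>a\<close> sending each color in \<open>I\<close> to the
  label of the vertex of that color.\<close>

definition color_shifted :: "vertex set set \<Rightarrow> bool" where
  "color_shifted \<Delta> \<longleftrightarrow>
     (\<forall>I a b. {(i, a i) | i. i \<in> I} \<in> \<Delta> \<longrightarrow> (\<forall>i\<in>I. 1 \<le> b i \<and> b i \<le> a i)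
        \<longrightarrow> {(i, b i) | i. i \<in> I} \<in> \<Delta>)"

definition color_selected :: "nat set \<Rightarrow> vertex set set \<Rightarrow> vertex set set" where
  "color_selected S \<Delta> = {F \<in> \<Delta>. color_set F \<subseteq> S}"

end

theory Submission
  imports Defs
begin

text \<open>For every face \<open>F\<close> of \<open>\<Delta>\<close> add a new color \<open>j\<close> with a single vertex, whose link is the full
  box of all faces obtained from subsets of \<open>F\<close> by lowering labels. If \<open>\<Sigma>\<close> is color-shifted with
  the same flag f-vector, the numbers \<open>f\<^bsub>{i,j}\<^esub>\<close> confine the link of the new vertex in \<open>\<Sigma>\<close> to the
  same box, and \<open>f\<^bsub>S \<union> {j}\<^esub>\<close>, where \<open>S\<close> is the color set of \<open>F\<close>, forces the box to be filled.
  Hence \<open>\<Gamma> \<subseteq> \<Sigma>\<close>, and equality follows by counting.\<close>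

section \<open>Lowering labels combined with passing to subsets\<close>

definition below :: "vertex set \<Rightarrow> vertex set set" where
  "below F = {G. inj_on fst G \<and> (\<forall>(i, a)\<in>G. 1 \<le> a \<and> (\<exists>b\<ge>a. (i, b) \<in> F))}"

lemma inj_on_fst_eq:
  assumes "inj_on fst F" "(i, a) \<in> F" "(i, b) \<in> F"
  shows "a = b"
  using inj_onD[OF assms(1) _ assms(2,3)] by simp

lemma below_trans:
  assumes "H \<in> below G" "G \<in> below F"
  shows "H \<in> below F"
proof -
  have "1 \<le> a \<and> (\<exists>b\<ge>a. (i, b) \<in> F)" if "(i, a) \<in> H" for i a
  proof -
    obtain b where b: "1 \<le> a" "a \<le> b" "(i, b) \<in> G"
      using assms(1) \<open>(i, a) \<in> H\<close> unfolding below_def by auto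
    then obtain c where "b \<le> c" "(i, c) \<in> F"
      using assms(2) unfolding below_def by auto
    with b show ?thesis using order_trans by blast
  qed
  then show ?thesis using assms(1) unfolding below_def by auto
qed

lemma below_subset: "H \<subseteq> G \<Longrightarrow> G \<in> below F \<Longrightarrow> H \<in> below F"
  unfolding below_def using inj_on_subset[of fst G H] by auto

lemma below_mono:
  assumes "F \<subseteq> F'" "G \<in> below F"
  shows "G \<in> below F'"
proof -
  have "1 \<le> a \<and> (\<exists>b\<ge>a. (i, b) \<in> F')" if "(i, a) \<in> G" for i a
    using assms(2) subsetD[OF assms(1)] that unfolding below_def by blast
  then show ?thesis using assms(2) unfolding below_def by auto
qed

section \<open>Color-shifted complexes as families closed under \<open>below\<close>\<close>

lemma colored_complex_finite:
  assumes "colored_complex m \<Delta>"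
  shows "finite \<Delta>"
  using assms finite_UnionD[of \<Delta>] unfolding colored_complex_def simplicial_complex_def by simp

lemma colored_complex_inj:
  assumes "colored_complex m \<Delta>" "F \<in> \<Delta>"
  shows "inj_on fst F"
  using assms unfolding colored_complex_def coloring_def inj_on_def by blast

lemma colored_complex_color_set:
  assumes "colored_complex m \<Delta>" "F \<in> \<Delta>"
  shows "color_set F \<subseteq> {1..m}"
  using assms unfolding colored_complex_def coloring_def color_set_def by blast

lemma colored_complex_label:
  assumes "colored_complex m \<Delta>" "F \<in> \<Delta>" "(i, a) \<in> F"
  shows "1 \<le> a" "a \<le> flag_f \<Delta> {i}"
proof -
  have "i \<in> {1..m}"
    using colored_complex_color_set[OF assms(1,2)] assms(3) unfolding color_set_def by force
  then have "{v \<in> \<Union>\<Delta>. fst v = i} = {(i, a) |a. 1 \<le> a \<and> a \<le> flag_f \<Delta> {i}}"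
    using assms(1) unfolding colored_complex_def by blast
  moreover have "(i, a) \<in> {v \<in> \<Union>\<Delta>. fst v = i}"
    using assms by auto
  ultimately show "1 \<le> a" "a \<le> flag_f \<Delta> {i}" by auto
qed

lemma colored_complex_self_below:
  assumes "colored_complex m \<Delta>" "F \<in> \<Delta>"
  shows "F \<in> below F"
  using colored_complex_inj[OF assms] colored_complex_label(1)[OF assms]
  unfolding below_def by auto

text \<open>Shiftedness compares only faces with the same colors, while \<open>G\<close> may omit
  colors of \<open>F\<close>. So \<open>F\<close> is first restricted to the colors of
  \<open>G\<close>, using closure under subsets, and only then are its labels lowered.\<close>

lemma shifted_below_closed:
  assumes "colored_complex m \<Delta>" "color_shifted \<Delta>" "F \<in> \<Delta>" "G \<in> below F"
  shows "G \<in> \<Delta>"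
proof -
  have G: "inj_on fst G" "\<And>i a. (i, a) \<in> G \<Longrightarrow> 1 \<le> a \<and> (\<exists>b\<ge>a. (i, b) \<in> F)"
    using assms(4) unfolding below_def by auto
  have inj: "\<And>i b b'. (i, b) \<in> F \<Longrightarrow> (i, b') \<in> F \<Longrightarrow> b = b'"
    using inj_on_fst_eq[OF colored_complex_inj[OF assms(1,3)]] .
  define I where "I = fst ` G"
  \<comment> \<open>The labels as functions of the color, as \<open>color_shifted\<close> demands.
    On \<open>I\<close> both descriptions are determined, since neither \<open>F\<close> nor
    \<open>G\<close> repeats a color.\<close>
  define a where "a i = (THE b. (i, b) \<in> F)" for i
  define b where "b i = (THE b. (i, b) \<in> G)" for i
  have a: "a i = x" if "(i, x) \<in> F" for i x
    unfolding a_def using that inj by blast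
  have b: "b i = x" if "(i, x) \<in> G" for i x
    unfolding b_def using that inj_on_fst_eq[OF G(1)] by blast
  have Geq: "G = {(i, b i) |i. i \<in> I}"
    unfolding I_def using b by force
  have ab: "(i, a i) \<in> F \<and> 1 \<le> b i \<and> b i \<le> a i" if "i \<in> I" for i
    using that a b G(2) unfolding I_def by force
  then have "{(i, a i) |i. i \<in> I} \<subseteq> F" by blast
  then have "{(i, a i) |i. i \<in> I} \<in> \<Delta>"
    using assms(1,3) unfolding colored_complex_def simplicial_complex_def by meson
  then show ?thesis
    using assms(2) ab unfolding color_shifted_def Geq by simp
qed

text \<open>A converse to the previous lemma. A face with distinct colors and positive labels lies
  below itself, so closure under \<open>below\<close> yields its subsets as well as its shifts;
  applied to single vertices, it leaves no gaps in the labeling.\<close>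

lemma below_closed_shifted_complex:
  assumes fin: "finite (\<Union>\<Delta>)"
    and inj: "\<And>F. F \<in> \<Delta> \<Longrightarrow> inj_on fst F"
    and col: "\<And>F. F \<in> \<Delta> \<Longrightarrow> color_set F \<subseteq> {1..m}"
    and lab: "\<And>F i a. F \<in> \<Delta> \<Longrightarrow> (i, a) \<in> F \<Longrightarrow> 1 \<le> a"
    and closed: "\<And>F G. F \<in> \<Delta> \<Longrightarrow> G \<in> below F \<Longrightarrow> G \<in> \<Delta>"
  shows "colored_complex m \<Delta>" "color_shifted \<Delta>"
proof -
  have sub: "G \<in> \<Delta>" if "F \<in> \<Delta>" "G \<subseteq> F" for F G
  proof -
    have "F \<in> below F" using inj lab that(1) unfolding below_def by auto
    then show ?thesis using below_subset closed that by blast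
  qed
  have "simplicial_complex (\<Union>\<Delta>) \<Delta>"
    unfolding simplicial_complex_def using fin sub by blast
  moreover have "coloring m color (\<Union>\<Delta>) \<Delta>"
    unfolding coloring_def using col inj
    by (auto simp: color_set_def image_subset_iff dest: inj_onD)
  moreover have "{v \<in> \<Union>\<Delta>. fst v = i} = {(i, a) |a. 1 \<le> a \<and> a \<le> flag_f \<Delta> {i}}" for i
  proof -
    define A where "A = {a. (i, a) \<in> \<Union>\<Delta>}"
    have finA: "finite A"
      by (rule finite_subset[of _ "snd ` \<Union>\<Delta>"]) (use fin in \<open>force simp: A_def\<close>)+
    have down: "b \<in> A" if "a \<in> A" "1 \<le> b" "b \<le> a" for a b
    proof -
      from that obtain F where F: "F \<in> \<Delta>" "(i, a) \<in> F" unfolding A_def by auto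
      then have "{(i, b)} \<in> below F" using that unfolding below_def by auto
      then have "{(i, b)} \<in> \<Delta>" using closed F by blast
      then show ?thesis unfolding A_def by blast
    qed
    have A1: "1 \<le> a" if "a \<in> A" for a using that lab unfolding A_def by auto
    \<comment> \<open>A nonempty finite set of positive integers that is closed downwards is an
      initial segment, with its maximum as cardinality.\<close>
    have Aeq: "A = {1..card A}"
    proof (cases "A = {}")
      case False
      have "A \<subseteq> {1..Max A}" using A1 Max_ge[OF finA] by auto
      moreover have "{1..Max A} \<subseteq> A" using down[OF Max_in[OF finA False]] by auto
      ultimately have "A = {1..Max A}" by (rule subset_antisym)
      then show ?thesis by (metis card_atLeastAtMost diff_Suc_1)
    qed auto
    \<comment> \<open>With distinct colors in each face, the faces with color set \<open>{i}\<close>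
      are the singletons, so the flag number counts exactly the labels in \<open>A\<close>.\<close>
    have "{F \<in> \<Delta>. color_set F = {i}} = (\<lambda>a. {(i, a)}) ` A"
    proof (intro equalityI subsetI)
      fix F assume "F \<in> {F \<in> \<Delta>. color_set F = {i}}"
      then have F: "F \<in> \<Delta>" "fst ` F = {i}" by (auto simp: color_set_def)
      then obtain a where a: "(i, a) \<in> F" by force
      have "v = (i, a)" if "v \<in> F" for v
        using inj_onD[OF inj[OF F(1)] _ that a] F(2) that by auto
      then have "F = {(i, a)}" using a by blast
      then show "F \<in> (\<lambda>a. {(i, a)}) ` A" using F(1) a unfolding A_def by auto
    next
      fix F assume "F \<in> (\<lambda>a. {(i, a)}) ` A"
      then show "F \<in> {F \<in> \<Delta>. color_set F = {i}}"
        unfolding A_def color_set_def using sub by auto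
    qed
    then have "flag_f \<Delta> {i} = card A"
      unfolding flag_f_def by (simp add: card_image inj_on_def)
    then have "A = {1..flag_f \<Delta> {i}}" using Aeq by simp
    moreover have "{v \<in> \<Union>\<Delta>. fst v = i} = {(i, a) |a. a \<in> A}" unfolding A_def by auto
    ultimately show ?thesis by auto
  qed
  ultimately show "colored_complex m \<Delta>" unfolding colored_complex_def by blast
  have "{(i, b i) |i. i \<in> I} \<in> below {(i, a i) |i. i \<in> I}"
    if "\<forall>i\<in>I. 1 \<le> b i \<and> b i \<le> a i" for I and a b :: "nat \<Rightarrow> nat"
    using that unfolding below_def by (auto simp: inj_on_def)
  then show "color_shifted \<Delta>" unfolding color_shifted_def using closed by blast
qed

section \<open>Construction of \<Gamma> from an enumeration of the faces of \<Delta> by new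
  colors\<close>

locale enumerated_shifted_complex =
  fixes n m :: nat and \<Delta> :: "vertex set set" and e :: "nat \<Rightarrow> vertex set"
  assumes complex: "colored_complex n \<Delta>"
    and shifted: "color_shifted \<Delta>"
    and n_le_m: "n \<le> m"
    and enum: "e ` {n<..m} = \<Delta>"
begin

text \<open>The only vertex of a new color \<open>j\<close> is \<open>(j, 1)\<close>, with link
  \<open>below (e j)\<close>. No face contains two new colors, so the added faces are cones over
  boxes inside \<Delta>.\<close>

definition \<Gamma> :: "vertex set set" where
  "\<Gamma> = \<Delta> \<union> {insert (j, 1) G |j G. j \<in> {n<..m} \<and> G \<in> below (e j)}"

lemma below_in: "n < j \<Longrightarrow> j \<le> m \<Longrightarrow> G \<in> below (e j) \<Longrightarrow> G \<in> \<Delta>"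
  using shifted_below_closed[OF complex shifted, of "e j"] enum by auto

lemma color_in_le: "F \<in> \<Delta> \<Longrightarrow> (i, a) \<in> F \<Longrightarrow> 1 \<le> i \<and> i \<le> n"
  using colored_complex_color_set[OF complex] unfolding color_set_def by force

lemma \<Gamma>_cases [consumes 1, case_names old new]:
  assumes "F \<in> \<Gamma>"
  obtains "F \<in> \<Delta>" | j G where "n < j" "j \<le> m" "G \<in> below (e j)" "G \<in> \<Delta>" "F = insert (j, 1) G"
  using assms below_in unfolding \<Gamma>_def by auto

lemma old_in: "F \<in> \<Delta> \<Longrightarrow> F \<in> \<Gamma>"
  unfolding \<Gamma>_def by blast

lemma new_in: "n < j \<Longrightarrow> j \<le> m \<Longrightarrow> G \<in> below (e j) \<Longrightarrow> insert (j, 1) G \<in> \<Gamma>"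
  unfolding \<Gamma>_def by auto

text \<open>Faces of \<Delta> have colors at most \<open>n\<close>, so a vertex of larger color can
  only be the apex of a cone face, and its color tells which cone.\<close>

lemma new_color:
  assumes "F \<in> \<Gamma>" "(j, x) \<in> F" "n < j"
  obtains G where "j \<le> m" "G \<in> below (e j)" "G \<in> \<Delta>" "F = insert (j, 1) G" "x = 1"
  using assms(1)
proof (cases rule: \<Gamma>_cases)
  case old
  then show ?thesis using color_in_le assms(2,3) by force
next
  case (new k G)
  then have "(j, x) = (k, 1)" using color_in_le assms(2,3) by force
  then show ?thesis using new that by auto
qed

lemma \<Gamma>_inj:
  assumes "F \<in> \<Gamma>"
  shows "inj_on fst F"
  using assms
proof (cases rule: \<Gamma>_cases)
  case (new j G)
  then have "j \<notin> fst ` G" using color_in_le by force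
  then show ?thesis using new colored_complex_inj[OF complex, of G] by auto
qed (rule colored_complex_inj[OF complex])

lemma \<Gamma>_label:
  assumes "F \<in> \<Gamma>" "(i, a) \<in> F"
  shows "1 \<le> a"
  using assms by (cases rule: \<Gamma>_cases) (auto dest: colored_complex_label(1)[OF complex])

lemma \<Gamma>_closed:
  assumes "F \<in> \<Gamma>" "H \<in> below F"
  shows "H \<in> \<Gamma>"
  using assms(1)
proof (cases rule: \<Gamma>_cases)
  case old
  then show ?thesis using old_in shifted_below_closed[OF complex shifted] assms(2) by blast
next
  case (new j G)
  define H' where "H' = H - {(j, 1)}"
  have H: "inj_on fst H" "\<And>i a. (i, a) \<in> H \<Longrightarrow> 1 \<le> a \<and> (\<exists>b\<ge>a. (i, b) \<in> insert (j, 1) G)"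
    using assms(2) new unfolding below_def by auto
  have "inj_on fst H'" using H(1) unfolding H'_def by (auto intro: inj_on_diff)
  \<comment> \<open>A vertex of \<open>H\<close> lying under \<open>(j, 1)\<close> has a label
    between 1 and 1, so it is the apex itself and was removed from \<open>H'\<close>.\<close>
  moreover have "1 \<le> a \<and> (\<exists>b\<ge>a. (i, b) \<in> G)" if "(i, a) \<in> H'" for i a
    using H(2)[of i a] that unfolding H'_def by (auto intro: le_antisym)
  ultimately have "H' \<in> below G" unfolding below_def by auto
  then have H': "H' \<in> below (e j)" using below_trans new by blast
  show ?thesis
  proof (cases "(j, 1) \<in> H")
    case True
    then have "H = insert (j, 1) H'" unfolding H'_def by auto
    then show ?thesis using new_in H' new by auto
  next
    case False
    then have "H = H'" unfolding H'_def by auto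
    then show ?thesis using old_in below_in H' new by auto
  qed
qed

lemma \<Gamma>_complex: "colored_complex m \<Gamma>" and \<Gamma>_shifted: "color_shifted \<Gamma>"
proof -
  have "F \<subseteq> \<Union>\<Delta> \<union> {n<..m} \<times> {1}" if "F \<in> \<Gamma>" for F
    using that by (cases rule: \<Gamma>_cases) force+
  moreover have "finite (\<Union>\<Delta>)"
    using complex unfolding colored_complex_def simplicial_complex_def by blast
  ultimately have fin: "finite (\<Union>\<Gamma>)"
    by (intro finite_subset[of "\<Union>\<Gamma>" "\<Union>\<Delta> \<union> {n<..m} \<times> {1}"]) auto
  have col: "color_set F \<subseteq> {1..m}" if "F \<in> \<Gamma>" for F
    using that n_le_m
    by (cases rule: \<Gamma>_cases) (force dest: color_in_le simp: color_set_def)+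
  show "colored_complex m \<Gamma>" "color_shifted \<Gamma>"
    by (rule below_closed_shifted_complex[OF fin];
        fact \<Gamma>_inj col \<Gamma>_label \<Gamma>_closed)+
qed

lemma \<Gamma>_selected: "color_selected {1..n} \<Gamma> = \<Delta>"
proof (intro equalityI subsetI)
  fix F assume "F \<in> color_selected {1..n} \<Gamma>"
  then have F: "F \<in> \<Gamma>" "color_set F \<subseteq> {1..n}" unfolding color_selected_def by auto
  from F(1) show "F \<in> \<Delta>"
    by (cases rule: \<Gamma>_cases) (use F(2) in \<open>auto simp: color_set_def\<close>)
next
  fix F assume "F \<in> \<Delta>"
  then show "F \<in> color_selected {1..n} \<Gamma>"
    unfolding color_selected_def using old_in colored_complex_color_set[OF complex] by blast
qed

section \<open>Upper bounds for flag f-numbers that involve a new color\<close>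

lemma \<Gamma>_flag_new:
  assumes "n < j"
  shows "flag_f \<Gamma> {j} \<le> 1"
proof -
  have "K = {(j, 1)}" if K: "K \<in> \<Gamma>" "color_set K = {j}" for K
  proof -
    obtain x where x: "(j, x) \<in> K" using K(2) unfolding color_set_def by force
    from new_color[OF K(1) x assms] obtain G where G: "G \<in> \<Delta>" "K = insert (j, 1) G" by metis
    have "G = {}" using color_in_le[OF G(1)] K(2) G(2) assms unfolding color_set_def by fastforce
    then show ?thesis using G by simp
  qed
  then have "{K \<in> \<Gamma>. color_set K = {j}} \<subseteq> {{(j, 1)}}" by blast
  from card_mono[OF _ this] show ?thesis unfolding flag_f_def by simp
qed

text \<open>Such a face is an edge from the apex \<open>(j, 1)\<close> to a vertex
  \<open>(i, a)\<close> of the box under \<open>e j\<close>. As \<open>e j\<close> has only one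
  vertex of color \<open>i\<close>, this forces \<open>a\<close> to be at most
  \<open>b\<close>.\<close>

lemma \<Gamma>_flag_edge:
  assumes "n < j" "i \<noteq> j" "(i, b) \<in> e j" "j \<le> m"
  shows "flag_f \<Gamma> {i, j} \<le> b"
proof -
  have ej: "e j \<in> \<Delta>" using enum assms by auto
  have "K \<in> (\<lambda>a. {(i, a), (j, 1)}) ` {1..b}" if K: "K \<in> \<Gamma>" "color_set K = {i, j}" for K
  proof -
    obtain x where x: "(j, x) \<in> K" using K(2) unfolding color_set_def by force
    from new_color[OF K(1) x assms(1)] obtain G
      where G: "G \<in> \<Delta>" "K = insert (j, 1) G" "G \<in> below (e j)" by metis
    obtain a where a: "(i, a) \<in> K" using K(2) unfolding color_set_def by force
    then have aG: "(i, a) \<in> G" using G assms by auto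
    then obtain b' where b': "1 \<le> a" "a \<le> b'" "(i, b') \<in> e j"
      using G(3) unfolding below_def by auto
    have "b' = b"
      using inj_on_fst_eq[OF colored_complex_inj[OF complex ej]] b'(3) assms(3) by blast
    moreover have "v = (i, a) \<or> v = (j, 1)" if "v \<in> K" for v
    proof -
      have "fst v \<in> {i, j}" using K(2) that unfolding color_set_def by blast
      then show ?thesis
        using inj_onD[OF \<Gamma>_inj[OF K(1)] _ that a] inj_onD[OF \<Gamma>_inj[OF K(1)] _ that, of "(j, 1)"] G(2)
        by auto
    qed
    then have "K = {(i, a), (j, 1)}" using a G(2) by blast
    ultimately show ?thesis using b'(1,2) by simp
  qed
  then have "{K \<in> \<Gamma>. color_set K = {i, j}} \<subseteq> (\<lambda>a. {(i, a), (j, 1)}) ` {1..b}" by blast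
  from card_mono[OF _ this] have "flag_f \<Gamma> {i, j} \<le> card ((\<lambda>a. {(i, a), (j, 1::nat)}) ` {1..b})"
    unfolding flag_f_def by simp
  also have "\<dots> \<le> b" using card_image_le[of "{1..b}"] by simp
  finally show ?thesis .
qed

section \<open>Uniqueness of \<Gamma> among color-shifted complexes with its flag f-vector\<close>

lemma \<Gamma>_unique:
  assumes \<Sigma>: "colored_complex m \<Sigma>" "color_shifted \<Sigma>"
    and flag: "\<And>S. S \<subseteq> {1..m} \<Longrightarrow> flag_f \<Sigma> S = flag_f \<Gamma> S"
  shows "\<Sigma> = \<Gamma>"
proof -
  note finS = colored_complex_finite[OF \<Sigma>(1)] and finG = colored_complex_finite[OF \<Gamma>_complex]
  \<comment> \<open>Every face of \<Sigma> with the color set of this cone turns out to be in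
    \<Gamma>. Equal finite counts then make the two families coincide, and the cone over
    \<open>e j\<close> belongs to the second.\<close>
  have cone_facet: "insert (j, 1) (e j) \<in> \<Sigma>" if j: "n < j" "j \<le> m" for j
  proof -
    have ej: "e j \<in> \<Delta>" using enum j by auto
    define C where "C = insert j (color_set (e j))"
    have C: "C \<subseteq> {1..m}"
      using colored_complex_color_set[OF complex ej] j n_le_m unfolding C_def by auto
    have "H \<in> \<Gamma>" if H: "H \<in> \<Sigma>" "color_set H = C" for H
    proof -
      obtain x where x: "(j, x) \<in> H" using H(2) unfolding C_def color_set_def by force
      \<comment> \<open>Labels of color \<open>j\<close> in \<Sigma> are bounded by
        \<open>flag_f \<Sigma> {j}\<close>, which agrees with \<Gamma> and so is at most 1.\<close>
      have "x = 1"
        using colored_complex_label[OF \<Sigma>(1) H(1) x] flag[of "{j}"] \<Gamma>_flag_new[OF j(1)] j by auto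
      with x have j1: "(j, 1) \<in> H" by simp
      define G where "G = H - {(j, 1)}"
      have Hinj: "inj_on fst H" using colored_complex_inj[OF \<Sigma>(1) H(1)] .
      have "1 \<le> a \<and> (\<exists>b\<ge>a. (i, b) \<in> e j)" if ia: "(i, a) \<in> G" for i a
      proof -
        have iH: "(i, a) \<in> H" and "i \<noteq> j"
          using ia inj_on_fst_eq[OF Hinj j1] unfolding G_def by auto
        moreover have "i \<in> C" using iH H(2) unfolding color_set_def by force
        ultimately obtain b where b: "(i, b) \<in> e j" unfolding C_def color_set_def by auto
        \<comment> \<open>Lowering \<open>(i, a)\<close> inside \<open>H\<close> produces
          \<open>a\<close> distinct edges of \<Sigma> with color set \<open>{i, j}\<close>. Since
          \<Gamma> has at most \<open>b\<close> of them, \<open>a\<close> cannot exceed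
          \<open>b\<close>.\<close>
        have edge: "{(i, a'), (j, 1)} \<in> \<Sigma>" if "a' \<in> {1..a}" for a'
        proof -
          have "{(i, a'), (j, 1)} \<in> below H"
            using that iH j1 \<open>i \<noteq> j\<close> unfolding below_def by auto
          then show ?thesis using shifted_below_closed[OF \<Sigma> H(1)] by blast
        qed
        have "a = card ((\<lambda>a'. {(i, a'), (j, 1::nat)}) ` {1..a})"
          using \<open>i \<noteq> j\<close> by (subst card_image) (auto simp: inj_on_def doubleton_eq_iff)
        also have "\<dots> \<le> flag_f \<Sigma> {i, j}"
          unfolding flag_f_def
          by (intro card_mono) (use finS edge in \<open>auto simp: color_set_def\<close>)
        also have "\<dots> = flag_f \<Gamma> {i, j}"
          using flag[of "{i, j}"] C \<open>i \<in> C\<close> j by auto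
        also have "\<dots> \<le> b" using \<Gamma>_flag_edge[OF j(1) \<open>i \<noteq> j\<close> b j(2)] .
        finally show ?thesis using b colored_complex_label(1)[OF \<Sigma>(1) H(1) iH] by blast
      qed
      then have "G \<in> below (e j)"
        unfolding below_def using Hinj by (auto simp: G_def intro: inj_on_diff)
      then have "insert (j, 1) G \<in> \<Gamma>" using new_in j by blast
      then show ?thesis using j1 unfolding G_def by (simp add: insert_absorb)
    qed
    then have "{H \<in> \<Sigma>. color_set H = C} = {H \<in> \<Gamma>. color_set H = C}"
      using flag[OF C] finG unfolding flag_f_def by (intro card_subset_eq) auto
    moreover have "insert (j, 1) (e j) \<in> \<Gamma>"
      using new_in j colored_complex_self_below[OF complex ej] by blast
    moreover have "color_set (insert (j, 1) (e j)) = C" unfolding C_def color_set_def by simp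
    ultimately show ?thesis by blast
  qed
  have sub: "F \<in> \<Sigma>" if F: "F \<in> \<Gamma>" for F
  proof -
    \<comment> \<open>Every face of \<Gamma> lies below one of the cones already found in \<Sigma>.
      For a face of \<Delta> the cone is the one over the face itself, which exists because
      \<open>e\<close> reaches every face.\<close>
    obtain j where j: "n < j" "j \<le> m" "F \<in> below (insert (j, 1) (e j))"
      using F
    proof (cases rule: \<Gamma>_cases)
      case old
      then obtain j where "n < j" "j \<le> m" "F = e j" using enum by auto
      then show ?thesis
        using that colored_complex_self_below[OF complex old] below_mono[of "e j"] by blast
    next
      case (new j G)
      then have "F \<in> below (insert (j, 1) (e j))"
        using \<Gamma>_inj[OF F] unfolding below_def by auto
      then show ?thesis using new that by blast
    qed
    then show ?thesis using shifted_below_closed[OF \<Sigma> cone_facet] by blast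
  qed
  have "F \<in> \<Gamma>" if F: "F \<in> \<Sigma>" for F
  proof -
    \<comment> \<open>For each color set occurring in \<Sigma>, the faces of \<Gamma> form a
      subfamily of those of \<Sigma> with the same finite cardinality, so nothing is left
      over.\<close>
    have "{H \<in> \<Gamma>. color_set H = color_set F} = {H \<in> \<Sigma>. color_set H = color_set F}"
      using flag[OF colored_complex_color_set[OF \<Sigma>(1) F]] finS sub
      unfolding flag_f_def by (intro card_subset_eq) auto
    then show ?thesis using F by blast
  qed
  with sub show ?thesis by blast
qed

end

section \<open>Choice of the number of colors\<close>

theorem theorem2:
  fixes n :: nat and \<Delta> :: "vertex set set"
  assumes "n \<ge> 1"
    and "colored_complex n \<Delta>"
    and "color_shifted \<Delta>"
  shows "\<exists>m \<Gamma>. n \<le> m \<and> colored_complex m \<Gamma> \<and>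
           color_selected {1..n} \<Gamma> = \<Delta> \<and>
           color_shifted \<Gamma> \<and>
           (\<forall>\<Sigma>. colored_complex m \<Sigma> \<and> color_shifted \<Sigma> \<and>
                 (\<forall>S. S \<subseteq> {1..m} \<longrightarrow> flag_f \<Sigma> S = flag_f \<Gamma> S) \<longrightarrow> \<Sigma> = \<Gamma>)"
proof -
  \<comment> \<open>One new color per face: the colors above \<open>n\<close> are then as many as
    the faces of \<Delta>, and a bijection supplies the enumeration.\<close>
  define m where "m = n + card \<Delta>"
  have "card {n<..m} = card \<Delta>" unfolding m_def by simp
  then obtain e where "bij_betw e {n<..m} \<Delta>"
    using finite_same_card_bij[of "{n<..m}"] colored_complex_finite[OF assms(2)] by blast
  then interpret enumerated_shifted_complex n m \<Delta> e
    using assms by unfold_locales (auto simp: m_def bij_betw_def)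
  show ?thesis
    using n_le_m \<Gamma>_complex \<Gamma>_selected \<Gamma>_shifted \<Gamma>_unique by blast
qed

end
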